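(* Let $I\subset\mathbb{R}$ be an interval with $0\in I$ and let $\eta\in\{-1,1\}$. For a continuous function $H:I\to\mathbb{R}$ put $$f_2(s)=\int_0^s\sinh\Big(2\eta\int_0^tH(u)\,du\Big)dt,\qquad g_2(s)=\int_0^s\cosh\Big(2\eta\int_0^tH(u)\,du\Big)dt,$$ and for $\mathbf b=(b_1,b_2,b_3)\in\mathbb{R}^3$ put $$\beta(s;H,\mathbf b)=\Big(\int_0^s-\eta\,\frac{g_2'(f_2-\eta b_1)-f_2'(g_2-\eta b_2)}{\sqrt{\eta[(f_2-\eta b_1)^2-(g_2-\eta b_2)^2]}}\,dt+b_3\,,\;0\,,\;\sqrt{\eta[(f_2-\eta b_1)^2-(g_2-\eta b_2)^2]}\Big).$$ (i) Let $\beta(s)=(x(s),0,z(s))$, $s\in I$, with $z>0$ and $x'^2-z'^2=\eta$, be the generating curve of a $C^2$ surface of revolution in $\mathbb{E}_1^3$ with spacelike axis $Ox$ and $C^0$ mean curvature $H(s)$. Then $\beta(s)=\beta(s;H,\mathbf b)$, where the constant vector $\mathbf b=(b_1,b_2,b_3)$ satisfies the initial conditions at $s=0$ given by $\beta(0)=(b_3,0,\sqrt{\eta(b_1^2-b_2^2)})$ and $\beta'(0)=[\eta(b_1^2-b_2^2)]^{-1/2}(b_1,0,b_2)$. (ii) Conversely, given a continuous function $H(s)$, $s\in I$, and a constant vector $(b_1,b_2,b_3)\in S_2\times\mathbb{R}$, where $$S_2=\bigcup_{s\in I}\{(X,Y):\ [X-\eta f_2(s)]^2-[Y-\eta g_2(s)]^2\neq0\},$$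 the $C^2$ curve $\beta(s;H(s),\mathbf b)$ generates a $C^2$ surface of revolution with $C^0$ mean curvature $H(s)$ when rotated around the (spacelike) $x$-axis.
   Context: $\mathbb{E}_1^3$ is $\mathbb{R}^3$ with coordinates $(x,y,z)$ and the metric $\langle u,v\rangle=u_1v_1+u_2v_2-u_3v_3$. A vector $v$ is spacelike if $\langle v,v\rangle>0$ or $v=0$, timelike if $\langle v,v\rangle<0$, lightlike if $\langle v,v\rangle=0$, $v\neq0$. Arc-length parametrization of a non-lightlike curve means $\langle\beta',\beta'\rangle=\eta\in\{-1,1\}$. Rotating $\beta(s)=(x(s),0,z(s))$, $z>0$, around the $x$-axis gives the surface of revolution $$X_I(s,\theta)=(x(s),z(s)\sinh\theta,z(s)\cosh\theta),\quad\theta\in\mathbb{R},$$ with unit normal chosen as $N=(-z',-x'\sinh\theta,-x'\cosh\theta)$. For a non-lightlike parametrized surface $X(u,v)$ with unit normal $N$, put $\epsilon=\langle N,N\rangle\in\{-1,1\}$ ($\epsilon=-1$ for spacelike, $+1$ for timelike surfaces), $g_{11}=\langle X_u,X_u\rangle$, $g_{12}=\langle X_u,X_v\rangle$, $g_{22}=\langle X_v,X_v\rangle$, $h_{11}=\langle X_{uu},N\rangle$, $h_{12}=\langle X_{uv},N\rangle$, $h_{22}=\langle X_{vv},N\rangle$. The mean curvature is $$H=\frac{\epsilon}{2}\,\frac{g_{11}h_{22}-2g_{12}h_{12}+g_{22}h_{11}}{g_{11}g_{22}-g_{12}^2}.$$ For the surface $X_I$ the mean curvature depends only on $s$, and $\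epsilon=-\eta$.
   Formalization: In (ii) the curve is taken only over those s in I with η[(f_2-ηb_1)^2-(g_2-ηb_2)^2]>0, since membership in S_2 does not make this positive on I (e.g. η=1, H=0, b_1=0 gives -(s-b_2)^2), and the formula is undefined elsewhere. *)

theory Defs
  imports "HOL-Analysis.Analysis"
begin

definition lorentz :: "real^3 \<Rightarrow> real^3 \<Rightarrow> real" where
  "lorentz u v = u$1 * v$1 + u$2 * v$2 - u$3 * v$3"

text \<open>Derivatives are taken within the parameter set, i.e. they are one-sided at those end points
  that belong to it. The parameter sets below have no isolated points, so they are unique.\<close>

definition C1_curve_on :: "real set \<Rightarrow> (real \<Rightarrow> 'a::real_normed_vector) \<Rightarrow> bool" where
  "C1_curve_on S c \<longleftrightarrow>
     (\<forall>s\<in>S. c differentiable (at s within S)) \<and>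
     continuous_on S (\<lambda>s. vector_derivative c (at s within S))"

definition C2_curve_on :: "real set \<Rightarrow> (real \<Rightarrow> 'a::real_normed_vector) \<Rightarrow> bool" where
  "C2_curve_on S c \<longleftrightarrow>
     C1_curve_on S c \<and> C1_curve_on S (\<lambda>s. vector_derivative c (at s within S))"

definition du :: "real set \<Rightarrow> (real \<Rightarrow> real \<Rightarrow> 'a::real_normed_vector) \<Rightarrow> real \<Rightarrow> real \<Rightarrow> 'a" where
  "du S X u v = vector_derivative (\<lambda>t. X t v) (at u within S)"

definition dv :: "real set \<Rightarrow> (real \<Rightarrow> real \<Rightarrow> 'a::real_normed_vector) \<Rightarrow> real \<Rightarrow> real \<Rightarrow> 'a" where
  "dv T X u v = vector_derivative (\<lambda>t. X u t) (at v within T)"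

definition C1_surface_on ::
    "real set \<Rightarrow> real set \<Rightarrow> (real \<Rightarrow> real \<Rightarrow> 'a::real_normed_vector) \<Rightarrow> bool" where
  "C1_surface_on S T X \<longleftrightarrow>
     (\<forall>u\<in>S. \<forall>v\<in>T. (\<lambda>t. X t v) differentiable (at u within S) \<and>
                   (\<lambda>t. X u t) differentiable (at v within T)) \<and>
     continuous_on (S \<times> T) (\<lambda>(u, v). du S X u v) \<and>
     continuous_on (S \<times> T) (\<lambda>(u, v). dv T X u v)"

definition C2_surface_on ::
    "real set \<Rightarrow> real set \<Rightarrow> (real \<Rightarrow> real \<Rightarrow> 'a::real_normed_vector) \<Rightarrow> bool" where
  "C2_surface_on S T X \<longleftrightarrow>
     C1_surface_on S T X \<and> C1_surface_on S T (du S X) \<and> C1_surface_on S T (dv T X)"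

definition g11 :: "real set \<Rightarrow> (real \<Rightarrow> real \<Rightarrow> real^3) \<Rightarrow> real \<Rightarrow> real \<Rightarrow> real" where
  "g11 S X u v = lorentz (du S X u v) (du S X u v)"

definition g12 :: "real set \<Rightarrow> real set \<Rightarrow> (real \<Rightarrow> real \<Rightarrow> real^3) \<Rightarrow> real \<Rightarrow> real \<Rightarrow> real" where
  "g12 S T X u v = lorentz (du S X u v) (dv T X u v)"

definition g22 :: "real set \<Rightarrow> (real \<Rightarrow> real \<Rightarrow> real^3) \<Rightarrow> real \<Rightarrow> real \<Rightarrow> real" where
  "g22 T X u v = lorentz (dv T X u v) (dv T X u v)"

definition h11 :: "real set \<Rightarrow> (real \<Rightarrow> real \<Rightarrow> real^3) \<Rightarrow> (real \<Rightarrow> real \<Rightarrow> real^3) \<Rightarrow>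
    real \<Rightarrow> real \<Rightarrow> real" where
  "h11 S X N u v = lorentz (du S (du S X) u v) (N u v)"

definition h12 :: "real set \<Rightarrow> real set \<Rightarrow> (real \<Rightarrow> real \<Rightarrow> real^3) \<Rightarrow> (real \<Rightarrow> real \<Rightarrow> real^3) \<Rightarrow>
    real \<Rightarrow> real \<Rightarrow> real" where
  "h12 S T X N u v = lorentz (dv T (du S X) u v) (N u v)"

definition h22 :: "real set \<Rightarrow> (real \<Rightarrow> real \<Rightarrow> real^3) \<Rightarrow> (real \<Rightarrow> real \<Rightarrow> real^3) \<Rightarrow>
    real \<Rightarrow> real \<Rightarrow> real" where
  "h22 T X N u v = lorentz (dv T (dv T X) u v) (N u v)"

definition nonlightlike_C2_surface_on ::
    "real set \<Rightarrow> real set \<Rightarrow> (real \<Rightarrow> real \<Rightarrow> real^3) \<Rightarrow> (real \<Rightarrow> real \<Rightarrow> real^3) \<Rightarrow> bool" where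
  "nonlightlike_C2_surface_on S T X N \<longleftrightarrow>
     C2_surface_on S T X \<and>
     (\<forall>u\<in>S. \<forall>v\<in>T. g11 S X u v * g22 T X u v - (g12 S T X u v)\<^sup>2 \<noteq> 0 \<and>
        lorentz (N u v) (du S X u v) = 0 \<and> lorentz (N u v) (dv T X u v) = 0 \<and>
        lorentz (N u v) (N u v) \<in> {-1, 1})"

text \<open>The factor \<open>lorentz (N u v) (N u v)\<close> is the sign \<open>\<epsilon>\<close> of the unit normal.\<close>

definition mean_curvature :: "real set \<Rightarrow> real set \<Rightarrow> (real \<Rightarrow> real \<Rightarrow> real^3) \<Rightarrow>
    (real \<Rightarrow> real \<Rightarrow> real^3) \<Rightarrow> real \<Rightarrow> real \<Rightarrow> real" where
  "mean_curvature S T X N u v =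
     lorentz (N u v) (N u v) / 2 *
     ((g11 S X u v * h22 T X N u v - 2 * g12 S T X u v * h12 S T X N u v
         + g22 T X u v * h11 S X N u v)
      / (g11 S X u v * g22 T X u v - (g12 S T X u v)\<^sup>2))"

definition rev_surface :: "(real \<Rightarrow> real^3) \<Rightarrow> real \<Rightarrow> real \<Rightarrow> real^3" where
  "rev_surface \<beta> s \<theta> = vector [\<beta> s $ 1, \<beta> s $ 3 * sinh \<theta>, \<beta> s $ 3 * cosh \<theta>]"

definition rev_normal :: "real set \<Rightarrow> (real \<Rightarrow> real^3) \<Rightarrow> real \<Rightarrow> real \<Rightarrow> real^3" where
  "rev_normal S \<beta> s \<theta> =
     (let \<beta>' = vector_derivative \<beta> (at s within S)
      in vector [- (\<beta>' $ 3), - (\<beta>' $ 1) * sinh \<theta>, - (\<beta>' $ 1) * cosh \<theta>])"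

text \<open>\<open>\<beta> = (x, 0, z)\<close> with \<open>z > 0\<close> and \<open>x'\<^sup>2 - z'\<^sup>2 = \<eta>\<close> is the generating curve of a \<open>C\<^sup>2\<close> surface of
  revolution about the x-axis with continuous mean curvature \<open>H(s)\<close>.\<close>

definition generates_rev_surface ::
    "real set \<Rightarrow> real \<Rightarrow> (real \<Rightarrow> real^3) \<Rightarrow> (real \<Rightarrow> real) \<Rightarrow> bool" where
  "generates_rev_surface S \<eta> \<beta> H \<longleftrightarrow>
     C2_curve_on S \<beta> \<and>
     (\<forall>s\<in>S. \<beta> s $ 2 = 0 \<and> \<beta> s $ 3 > 0 \<and>
        lorentz (vector_derivative \<beta> (at s within S)) (vector_derivative \<beta> (at s within S)) = \<eta>) \<and>
     nonlightlike_C2_surface_on S UNIV (rev_surface \<beta>) (rev_normal S \<beta>) \<and>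
     continuous_on S H \<and>
     (\<forall>s\<in>S. \<forall>\<theta>. mean_curvature S UNIV (rev_surface \<beta>) (rev_normal S \<beta>) s \<theta> = H s)"

definition f2 :: "real \<Rightarrow> (real \<Rightarrow> real) \<Rightarrow> real \<Rightarrow> real" where
  "f2 \<eta> H s = (LBINT t=0..s. sinh (2 * \<eta> * (LBINT u=0..t. H u)))"

definition g2 :: "real \<Rightarrow> (real \<Rightarrow> real) \<Rightarrow> real \<Rightarrow> real" where
  "g2 \<eta> H s = (LBINT t=0..s. cosh (2 * \<eta> * (LBINT u=0..t. H u)))"

definition radicand :: "real \<Rightarrow> (real \<Rightarrow> real) \<Rightarrow> real^3 \<Rightarrow> real \<Rightarrow> real" where
  "radicand \<eta> H b s = \<eta> * ((f2 \<eta> H s - \<eta> * b$1)\<^sup>2 - (g2 \<eta> H s - \<eta> * b$2)\<^sup>2)"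

text \<open>The curve is meaningful only at parameters \<open>s\<close> with \<open>radicand \<eta> H b s > 0\<close>. The radicand is a
  product of two strictly monotone functions, so it has at most two zeros, and the integrand below is
  absolutely integrable across them. If the path from \<open>0\<close> to \<open>s\<close> meets parameters with negative
  radicand, where \<open>sqrt y = - sqrt (- y)\<close>, this affects the first coordinate only by an additive
  constant on each interval of positivity, i.e. by a translation along the axis of revolution.\<close>

definition rev_curve :: "real \<Rightarrow> (real \<Rightarrow> real) \<Rightarrow> real^3 \<Rightarrow> real \<Rightarrow> real^3" where
  "rev_curve \<eta> H b s = vector
     [(LBINT t=0..s. - \<eta> *
         ((deriv (g2 \<eta> H) t * (f2 \<eta> H t - \<eta> * b$1) - deriv (f2 \<eta> H) t * (g2 \<eta> H t - \<eta> * b$2))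
          / sqrt (radicand \<eta> H b t))) + b$3,
      0,
      sqrt (radicand \<eta> H b s)]"

definition S2 :: "real set \<Rightarrow> real \<Rightarrow> (real \<Rightarrow> real) \<Rightarrow> (real \<times> real) set" where
  "S2 I \<eta> H = (\<Union>s\<in>I. {(X, Y). (X - \<eta> * f2 \<eta> H s)\<^sup>2 - (Y - \<eta> * g2 \<eta> H s)\<^sup>2 \<noteq> 0})"

end

theory Submission
  imports Defs
begin

text \<open>Let \<open>\<phi> s = 2 * \<eta> * (LBINT u=0..s. H u)\<close>. For a profile curve \<open>(x, 0, z)\<close> of unit speed, prescribing the
  mean curvature \<open>H\<close> amounts to the linear system \<open>p' = \<phi>' * q\<close>, \<open>q' = \<phi>' * p - 1\<close> for
  \<open>p = - \<eta> * z * x'\<close> and \<open>q = \<eta> * z * z'\<close>. The hyperbolic rotation \<open>F = cosh \<phi> * p - sinh \<phi> * q\<close>,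
  \<open>G = sinh \<phi> * p - cosh \<phi> * q\<close> turns it into \<open>F' = sinh \<phi>\<close>, \<open>G' = cosh \<phi>\<close>, so that \<open>F\<close> and \<open>G\<close> are \<open>f2\<close>
  and \<open>g2\<close> up to constants; unit speed gives \<open>z\<^sup>2 = \<eta> * (F\<^sup>2 - G\<^sup>2)\<close>, and \<open>x\<close> is recovered by
  integrating \<open>x' = - \<eta> * p / z\<close>. For the converse this integrand must be integrable across the zeros
  of \<open>z\<close>: it splits into two terms that are bounded multiples of \<open>B' / sqrt B\<close> with \<open>B = G \<plusminus> F\<close>
  strictly increasing.\<close>

subsection \<open>Integration on intervals\<close>

text \<open>\<open>I\<close> may be open, half-open or unbounded, and \<open>s\<close> may be one of
  its end points. The compact interval found here joins \<open>0\<close> to \<open>s\<close> and is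
  a neighbourhood of \<open>s\<close> relative to \<open>I\<close>, so limits at \<open>s\<close>
  within \<open>I\<close> can be computed within it.\<close>

lemma interval_rel_neighbourhood:
  fixes I :: "real set"
  assumes I: "is_interval I" "0 \<in> I" and s: "s \<in> I"
  obtains c d U where "{c..d} \<subseteq> I" "0 \<in> {c..d}" "s \<in> {c..d}" "open U" "s \<in> U" "I \<inter> U \<subseteq> {c..d}"
proof -
  \<comment> \<open>Either \<open>c\<close> lies strictly to the left of \<open>s\<close>, or
    \<open>s\<close> is the least point of \<open>I\<close> and nothing is lost on that
    side.\<close>
  have "\<exists>c\<in>I. c \<le> 0 \<and> c \<le> s \<and> (c < s \<or> (\<forall>y\<in>I. s \<le> y))"
  proof (cases "s \<le> 0 \<and> (\<exists>y\<in>I. y < s)")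
    case True
    then obtain y where "y \<in> I" "y < s" "s \<le> 0" by blast
    then show ?thesis by (intro bexI[of _ y]) auto
  next
    case False
    then show ?thesis
      using I s by (intro bexI[of _ "min 0 s"]) (auto simp: min_def not_less)
  qed
  then obtain c where c: "c \<in> I" "c \<le> 0" "c \<le> s" "c < s \<or> (\<forall>y\<in>I. s \<le> y)" by blast
  have "\<exists>d\<in>I. 0 \<le> d \<and> s \<le> d \<and> (s < d \<or> (\<forall>y\<in>I. y \<le> s))"
  proof (cases "0 \<le> s \<and> (\<exists>y\<in>I. s < y)")
    case True
    then obtain y where "y \<in> I" "s < y" "0 \<le> s" by blast
    then show ?thesis by (intro bexI[of _ y]) auto
  next
    case False
    then show ?thesis
      using I s by (intro bexI[of _ "max 0 s"]) (auto simp: max_def not_less)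
  qed
  then obtain d where d: "d \<in> I" "0 \<le> d" "s \<le> d" "s < d \<or> (\<forall>y\<in>I. y \<le> s)" by blast
  \<comment> \<open>On a side where \<open>s\<close> is an end point of \<open>I\<close>, no bound
    is imposed, which keeps \<open>U\<close> open and \<open>s\<close> inside it.\<close>
  define U where "U = (if c < s then {c<..} else UNIV) \<inter> (if s < d then {..<d} else UNIV)"
  have "{c..d} \<subseteq> I"
    using mem_is_interval_1_I[OF I(1) c(1) d(1)] by auto
  moreover have "c \<le> x \<and> x \<le> d" if "x \<in> I" "x \<in> U" for x
    using that c d unfolding U_def by (auto split: if_splits)
  then have "I \<inter> U \<subseteq> {c..d}" by auto
  moreover have "open U" "s \<in> U" unfolding U_def by auto
  ultimately show ?thesis using that[of c d U] c d by auto
qed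

text \<open>The fundamental theorem with continuity required at the point \<open>s\<close> only.
  This form suits integrands that are singular elsewhere in \<open>I\<close> but still integrable on
  compact subintervals.\<close>

lemma interval_integral_has_derivative_within:
  fixes f :: "real \<Rightarrow> real"
  assumes I: "is_interval I" "0 \<in> I" and s: "s \<in> I"
    and int: "\<And>c d. {c..d} \<subseteq> I \<Longrightarrow> set_integrable lborel {c..d} f"
    and cont: "continuous (at s within I) f"
  shows "((\<lambda>u. LBINT t=0..u. f t) has_real_derivative f s) (at s within I)"
proof -
  obtain c d U where cd: "{c..d} \<subseteq> I" "0 \<in> {c..d}" "s \<in> {c..d}"
    and U: "open U" "s \<in> U" "I \<inter> U \<subseteq> {c..d}"
    using interval_rel_neighbourhood[OF I s] by metis
  \<comment> \<open>Moving the base point from \<open>0\<close> to \<open>c\<close> changes the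
    integral by a constant and removes the sign change at \<open>u < 0\<close>.\<close>
  have eq: "(LBINT t=0..u. f t) = integral {c..u} f - integral {c..0} f" if u: "u \<in> {c..d}" for u
  proof -
    have sub: "set_integrable lborel {a..b} f" if "c \<le> a" "b \<le> d" for a b
      using int[of a b] cd(1) that by (meson atLeastatMost_subset_iff subset_trans)
    have comb: "integral {c..a} f + integral {a..b} f = integral {c..b} f"
      if "c \<le> a" "a \<le> b" "b \<le> d" for a b
      using Henstock_Kurzweil_Integration.integral_combine[of c a b f] sub[of c b] that
        set_borel_integral_eq_integral(1) by auto
    have base: "(LBINT t=ereal a..ereal b. f t) = integral {a..b} f"
      if "c \<le> a" "a \<le> b" "b \<le> d" for a b
      using interval_integral_eq_integral[of a b f] sub[of a b] that by auto
    show ?thesis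
    proof (cases "0 \<le> u")
      case True
      then show ?thesis using base[of 0 u] comb[of 0 u] u cd by (simp add: zero_ereal_def)
    next
      case False
      then show ?thesis using base[of u 0] comb[of u 0] u cd
          interval_integral_endpoints_reverse[of 0 "ereal u" f] by (simp add: zero_ereal_def)
    qed
  qed
  have at: "at s within I = at s within {c..d}"
    by (rule at_within_nhd[OF U(2,1)]) (use U(3) cd(1) in auto)
  have "f integrable_on {c..d}"
    using int[OF cd(1)] set_borel_integral_eq_integral(1) by blast
  then have "((\<lambda>u. integral {c..u} f) has_vector_derivative f s) (at s within {c..d})"
    using integral_has_vector_derivative_continuous_at[of f c d s "{}"] cd(3) cont at by simp
  then have "((\<lambda>u. integral {c..u} f - integral {c..0} f) has_vector_derivative f s)
      (at s within {c..d})"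
    using has_vector_derivative_diff[OF _ has_vector_derivative_const] by fastforce
  then have "((\<lambda>u. LBINT t=0..u. f t) has_vector_derivative f s) (at s within {c..d})"
    by (rule has_vector_derivative_transform[rotated 2]) (use cd eq in auto)
  then show ?thesis
    unfolding at has_real_derivative_iff_has_vector_derivative .
qed

text \<open>The real \<open>sqrt\<close> is odd, so for negative \<open>x\<close> the two signs
  cancel; at \<open>0\<close> both sides are \<open>0\<close> by the convention for
  division.\<close>

lemma divide_sqrt_self: "x / sqrt x = sqrt \<bar>x\<bar>"
  by (cases "x \<ge> 0") (use real_div_sqrt[of x] real_div_sqrt[of "-x"] in \<open>auto simp: real_sqrt_minus\<close>)

text \<open>The integrand is a continuous multiple of the derivative of \<open>\<lambda>t. 2 * sqrt \<bar>B t\<bar>\<close>.\<close>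

lemma set_integrable_mult_derivative_over_sqrt:
  fixes B B' k :: "real \<Rightarrow> real"
  assumes B: "\<And>t. t \<in> {c..d} \<Longrightarrow> (B has_real_derivative B' t) (at t within {c..d})"
    and pos: "\<And>t. t \<in> {c..d} \<Longrightarrow> B' t > 0"
    and B': "continuous_on {c..d} B'" and k: "continuous_on {c..d} k"
  shows "set_integrable lborel {c..d} (\<lambda>t. k t * (B' t / sqrt (B t)))"
proof (cases "c \<le> d")
  case False
  then show ?thesis by (simp add: set_integrable_def)
next
  case True
  have contB: "continuous_on {c..d} B"
    using B DERIV_continuous_on by blast
  have inj: "B x < B y" if "x \<in> {c..d}" "y \<in> {c..d}" "x < y" for x y
  proof (rule DERIV_pos_imp_increasing_open[OF that(3)])
    fix t assume "x < t" "t < y"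
    then have "t \<in> {c..d}" "at t within {c..d} = at t"
      using that by (auto intro!: at_within_interior)
    then show "\<exists>D. DERIV B t :> D \<and> 0 < D" using B[of t] pos[of t] by auto
  next
    show "continuous_on {x..y} B" using that by (intro continuous_on_subset[OF contB]) auto
  qed
  \<comment> \<open>By strict monotonicity \<open>B\<close> has at most one zero, the only point
    where \<open>sqrt (B t)\<close> can fail to be differentiable in the interior.\<close>
  define S where "S = {t \<in> {c..d}. B t = 0}"
  have "finite S"
  proof (cases "S = {}")
    case False
    then obtain p where "p \<in> S" by auto
    have "t = p" if "t \<in> S" for t
      using inj[of t p] inj[of p t] \<open>p \<in> S\<close> that unfolding S_def
      by (cases t p rule: linorder_cases) auto
    then have "S \<subseteq> {p}" by blast
    then show ?thesis using finite_subset by blast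
  qed auto
  \<comment> \<open>Since \<open>sqrt\<close> is odd and continuous, \<open>sqrt (B t)\<close> is an
    antiderivative on both sides of the zero and continuous across it, so one finite exceptional set
    suffices.\<close>
  have "((\<lambda>t. B' t / (2 * sqrt \<bar>B t\<bar>)) has_integral sqrt (B d) - sqrt (B c)) {c..d}"
  proof (rule fundamental_theorem_of_calculus_interior_strong[OF \<open>finite S\<close> True])
    fix t assume t: "t \<in> {c<..<d} - S"
    then have "t \<in> {c..d}" "at t within {c..d} = at t" "B t \<noteq> 0"
      unfolding S_def by (auto intro!: at_within_interior)
    then have "(B has_real_derivative B' t) (at t)" using B[of t] by simp
    moreover have "(sqrt has_real_derivative 1 / (2 * sqrt \<bar>B t\<bar>)) (at (B t))"
      using \<open>B t \<noteq> 0\<close>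
      by (intro DERIV_real_sqrt_generic) (auto simp: real_sqrt_minus field_simps)
    ultimately have "((\<lambda>t. sqrt (B t)) has_real_derivative 1 / (2 * sqrt \<bar>B t\<bar>) * B' t) (at t)"
      by (rule DERIV_chain2[rotated])
    then show "((\<lambda>t. sqrt (B t)) has_vector_derivative B' t / (2 * sqrt \<bar>B t\<bar>)) (at t)"
      by (simp add: has_real_derivative_iff_has_vector_derivative)
  next
    show "continuous_on {c..d} (\<lambda>t. sqrt (B t))" by (intro continuous_intros contB)
  qed
  \<comment> \<open>The integrand is nonnegative, so gauge integrability already gives absolute
    integrability.\<close>
  then have "(\<lambda>t. B' t / (2 * sqrt \<bar>B t\<bar>)) absolutely_integrable_on {c..d}"
    by (intro nonnegative_absolutely_integrable_1)
      (use pos in \<open>auto simp: less_imp_le integrable_on_def\<close>)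
  \<comment> \<open>Cutting off by the indicator gives Borel functions on the whole line, which
    allows the passage from the completed Lebesgue measure to \<open>lborel\<close>.\<close>
  define iB where "iB t = indicat_real {c..d} t *\<^sub>R B t" for t
  define iB' where "iB' t = indicat_real {c..d} t *\<^sub>R B' t" for t
  define ik where "ik t = indicat_real {c..d} t *\<^sub>R k t" for t
  have meas[measurable]: "iB \<in> borel_measurable borel" "iB' \<in> borel_measurable borel"
    "ik \<in> borel_measurable borel"
    unfolding iB_def[abs_def] iB'_def[abs_def] ik_def[abs_def]
    by (intro borel_measurable_continuous_on_indicator contB B' k; simp)+
  have "(\<lambda>t. indicat_real {c..d} t *\<^sub>R (B' t / (2 * sqrt \<bar>B t\<bar>))) = (\<lambda>t. iB' t / (2 * sqrt \<bar>iB t\<bar>))"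
    by (auto simp: iB_def iB'_def indicator_def)
  then have "integrable (completion lborel) (\<lambda>t. iB' t / (2 * sqrt \<bar>iB t\<bar>))"
    using \<open>_ absolutely_integrable_on _\<close> unfolding set_integrable_def by simp
  then have int: "integrable lborel (\<lambda>t. iB' t / (2 * sqrt \<bar>iB t\<bar>))"
    by (subst (asm) integrable_completion) auto
  obtain K where K: "\<And>t. t \<in> {c..d} \<Longrightarrow> \<bar>k t\<bar> \<le> K"
    using compact_imp_bounded[OF compact_continuous_image[OF k compact_Icc]]
    unfolding bounded_iff by (metis imageI real_norm_def)
  have "integrable lborel (\<lambda>t. ik t * (iB' t / sqrt (iB t)))"
  proof (rule Bochner_Integration.integrable_bound)
    show "integrable lborel (\<lambda>t. 2 * K * (iB' t / (2 * sqrt \<bar>iB t\<bar>)))"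
      using integrable_mult_right[OF int, of "2 * K"] by (simp only: mult_ac)
    show "AE t in lborel. norm (ik t * (iB' t / sqrt (iB t)))
        \<le> norm (2 * K * (iB' t / (2 * sqrt \<bar>iB t\<bar>)))"
    proof (rule AE_I2)
      fix t
      have abs_sqrt: "\<bar>sqrt x\<bar> = sqrt \<bar>x\<bar>" for x
        by (cases "x \<ge> 0") (auto simp: real_sqrt_minus)
      have "\<bar>k t\<bar> * (\<bar>B' t\<bar> / sqrt \<bar>B t\<bar>) \<le> \<bar>K\<bar> * (\<bar>B' t\<bar> / sqrt \<bar>B t\<bar>)" if "t \<in> {c..d}"
        by (rule mult_right_mono) (use K[OF that] in auto)
      then show "norm (ik t * (iB' t / sqrt (iB t))) \<le> norm (2 * K * (iB' t / (2 * sqrt \<bar>iB t\<bar>)))"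
        by (cases "t \<in> {c..d}") (simp_all add: ik_def iB_def iB'_def abs_mult abs_sqrt)
    qed
  qed simp
  moreover have "(\<lambda>t. ik t * (iB' t / sqrt (iB t)))
      = (\<lambda>t. indicat_real {c..d} t *\<^sub>R (k t * (B' t / sqrt (B t))))"
    by (auto simp: iB_def iB'_def ik_def indicator_def)
  ultimately show ?thesis unfolding set_integrable_def by simp
qed

subsection \<open>Surfaces of revolution\<close>

lemma vector3_eq_axis:
  "(vector [a, b, c] :: real^3) = a *\<^sub>R axis 1 1 + b *\<^sub>R axis 2 1 + c *\<^sub>R axis 3 1"
  by (simp add: vec_eq_iff forall_3 axis_def)

lemma has_vector_derivative_vector3:
  assumes "(f has_vector_derivative f') F" "(g has_vector_derivative g') F"
    "(h has_vector_derivative h') F"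
  shows "((\<lambda>t. vector [f t, g t, h t] :: real^3) has_vector_derivative vector [f', g', h']) F"
  unfolding vector3_eq_axis
  by (intro has_vector_derivative_add assms
      bounded_linear.has_vector_derivative[OF bounded_linear_scaleR_left])

lemma continuous_on_vector3:
  fixes f g h :: "'a::topological_space \<Rightarrow> real"
  assumes "continuous_on S f" "continuous_on S g" "continuous_on S h"
  shows "continuous_on S (\<lambda>t. vector [f t, g t, h t] :: real^3)"
  unfolding vector3_eq_axis by (intro continuous_intros assms)

lemma has_vector_derivative_vec_nth:
  fixes f :: "real \<Rightarrow> real^'n"
  assumes "(f has_vector_derivative f') F"
  shows "((\<lambda>t. f t $ i) has_real_derivative f' $ i) F"
  using bounded_linear.has_vector_derivative[OF bounded_linear_vec_nth assms, of i]
  by (simp add: has_real_derivative_iff_has_vector_derivative)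

lemma C2_curve_on_I:
  assumes nt: "\<And>s. s \<in> S \<Longrightarrow> at s within S \<noteq> bot"
    and d: "\<And>s. s \<in> S \<Longrightarrow> (c has_vector_derivative c1 s) (at s within S)"
    and d1: "\<And>s. s \<in> S \<Longrightarrow> (c1 has_vector_derivative c2 s) (at s within S)"
    and c2: "continuous_on S c2"
  shows "C2_curve_on S c"
proof -
  define D where "D s = vector_derivative c (at s within S)" for s
  have D: "D s = c1 s" if "s \<in> S" for s
    unfolding D_def using vector_derivative_within[OF nt d] that by blast
  have dD: "(D has_vector_derivative c2 s) (at s within S)" if "s \<in> S" for s
    using has_vector_derivative_transform[OF that D d1[OF that]] .
  have D2: "vector_derivative D (at s within S) = c2 s" if "s \<in> S" for s
    using vector_derivative_within[OF nt dD] that by blast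
  have "continuous_on S D"
    using dD has_vector_derivative_continuous continuous_on_eq_continuous_within by blast
  moreover have "continuous_on S (\<lambda>s. vector_derivative D (at s within S))"
    using D2 c2 by simp
  ultimately show ?thesis
    using d dD differentiableI_vector
    unfolding C2_curve_on_def C1_curve_on_def D_def[abs_def] by blast
qed

lemma C2_curve_onD:
  fixes c :: "real \<Rightarrow> 'a::real_normed_vector"
  assumes "C2_curve_on S c"
  defines "D \<equiv> \<lambda>s. vector_derivative c (at s within S)"
  defines "D2 \<equiv> \<lambda>s. vector_derivative D (at s within S)"
  shows "s \<in> S \<Longrightarrow> (c has_vector_derivative D s) (at s within S)"
    and "s \<in> S \<Longrightarrow> (D has_vector_derivative D2 s) (at s within S)"
    and "continuous_on S D2"
  using assms unfolding C2_curve_on_def C1_curve_on_def D_def D2_def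
  by (auto simp: vector_derivative_works)

section \<open>Derivatives and fundamental forms of the surface of revolution\<close>

definition rev_tangent :: "(real \<Rightarrow> real^3) \<Rightarrow> real \<Rightarrow> real \<Rightarrow> real^3" where
  "rev_tangent \<beta> s \<theta> = vector [0, \<beta> s $ 3 * cosh \<theta>, \<beta> s $ 3 * sinh \<theta>]"

text \<open>\<open>rev_tangent\<close> and \<open>rev_radius\<close> are the first and second
  derivatives of \<open>rev_surface\<close> in the angle \<theta>.\<close>

definition rev_radius :: "(real \<Rightarrow> real^3) \<Rightarrow> real \<Rightarrow> real \<Rightarrow> real^3" where
  "rev_radius \<beta> s \<theta> = vector [0, \<beta> s $ 3 * sinh \<theta>, \<beta> s $ 3 * cosh \<theta>]"

lemma rev_surface_dv:
  "(rev_surface \<beta> s has_vector_derivative rev_tangent \<beta> s \<theta>) (at \<theta> within T)"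
  "(rev_tangent \<beta> s has_vector_derivative rev_radius \<beta> s \<theta>) (at \<theta> within T)"
  unfolding rev_surface_def[abs_def] rev_tangent_def[abs_def] rev_radius_def[abs_def]
  by (rule has_vector_derivative_vector3;
      force intro!: derivative_eq_intros simp: has_real_derivative_iff_has_vector_derivative[symmetric])+

text \<open>For fixed \<theta> the surface point depends linearly on the profile point, so
  differentiating in \<open>s\<close> amounts to inserting the derivative of the profile, here as a
  constant curve.\<close>

lemma rev_surface_du:
  assumes "(\<beta> has_vector_derivative \<beta>') (at s within S)"
  shows "((\<lambda>t. rev_surface \<beta> t \<theta>) has_vector_derivative rev_surface (\<lambda>_. \<beta>') s \<theta>) (at s within S)"
    "((\<lambda>t. rev_tangent \<beta> t \<theta>) has_vector_derivative rev_tangent (\<lambda>_. \<beta>') s \<theta>) (at s within S)"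
  unfolding rev_surface_def[abs_def] rev_tangent_def[abs_def]
  by (rule has_vector_derivative_vector3;
      force intro!: derivative_eq_intros has_vector_derivative_vec_nth[OF assms]
      simp: has_real_derivative_iff_has_vector_derivative[symmetric])+

lemma continuous_on_rev_surface:
  assumes "continuous_on S \<beta>"
  shows "continuous_on (S \<times> T) (\<lambda>(s, \<theta>). rev_surface \<beta> s \<theta>)"
    "continuous_on (S \<times> T) (\<lambda>(s, \<theta>). rev_tangent \<beta> s \<theta>)"
    "continuous_on (S \<times> T) (\<lambda>(s, \<theta>). rev_radius \<beta> s \<theta>)"
proof -
  have "continuous_on (S \<times> T) (\<lambda>p. \<beta> (fst p))"
    by (rule continuous_on_compose2[OF assms]) (auto intro: continuous_intros)
  then show "continuous_on (S \<times> T) (\<lambda>(s, \<theta>). rev_surface \<beta> s \<theta>)"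
    "continuous_on (S \<times> T) (\<lambda>(s, \<theta>). rev_tangent \<beta> s \<theta>)"
    "continuous_on (S \<times> T) (\<lambda>(s, \<theta>). rev_radius \<beta> s \<theta>)"
    unfolding rev_surface_def rev_tangent_def rev_radius_def case_prod_unfold
    by (intro continuous_on_vector3 continuous_intros; simp)+
qed

text \<open>Naming the first two derivatives of the profile avoids nested
  \<open>vector_derivative\<close> terms; \<open>nontrivial\<close> makes these derivatives
  unique.\<close>

locale C2_profile =
  fixes S :: "real set" and \<beta> \<beta>1 \<beta>2 :: "real \<Rightarrow> real^3"
  assumes nontrivial: "\<And>s. s \<in> S \<Longrightarrow> at s within S \<noteq> bot"
    and deriv1: "\<And>s. s \<in> S \<Longrightarrow> (\<beta> has_vector_derivative \<beta>1 s) (at s within S)"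
    and deriv2: "\<And>s. s \<in> S \<Longrightarrow> (\<beta>1 has_vector_derivative \<beta>2 s) (at s within S)"
    and cont2: "continuous_on S \<beta>2"
begin

lemma vector_derivative_profile: "s \<in> S \<Longrightarrow> vector_derivative \<beta> (at s within S) = \<beta>1 s"
  using vector_derivative_within[OF nontrivial deriv1] by blast

lemma surface_has_derivatives:
  assumes "s \<in> S"
  shows "((\<lambda>t. rev_surface \<beta> t \<theta>) has_vector_derivative rev_surface \<beta>1 s \<theta>) (at s within S)"
    "((\<lambda>t. rev_surface \<beta>1 t \<theta>) has_vector_derivative rev_surface \<beta>2 s \<theta>) (at s within S)"
    "((\<lambda>t. rev_tangent \<beta> t \<theta>) has_vector_derivative rev_tangent \<beta>1 s \<theta>) (at s within S)"
  using rev_surface_du[OF deriv1[OF assms], of \<theta>] rev_surface_du[OF deriv2[OF assms], of \<theta>]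
  by (simp_all add: rev_surface_def rev_tangent_def)

lemma du_surface: "s \<in> S \<Longrightarrow> du S (rev_surface \<beta>) s \<theta> = rev_surface \<beta>1 s \<theta>"
  unfolding du_def using vector_derivative_within[OF nontrivial surface_has_derivatives(1)] by blast

lemma dv_surface: "dv UNIV (rev_surface \<beta>) = rev_tangent \<beta>"
  "dv UNIV (rev_tangent \<beta>) = rev_radius \<beta>"
  by (auto simp: fun_eq_iff dv_def intro!: vector_derivative_at rev_surface_dv)

lemma du_du_has_derivative:
  "s \<in> S \<Longrightarrow> ((\<lambda>t. du S (rev_surface \<beta>) t \<theta>) has_vector_derivative rev_surface \<beta>2 s \<theta>) (at s within S)"
  by (rule has_vector_derivative_transform[OF _ du_surface surface_has_derivatives(2)])

lemma dv_du_has_derivative: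
  assumes "s \<in> S"
  shows "(du S (rev_surface \<beta>) s has_vector_derivative rev_tangent \<beta>1 s \<theta>) (at \<theta>)"
proof -
  have "du S (rev_surface \<beta>) s = rev_surface \<beta>1 s" using du_surface[OF assms] by auto
  then show ?thesis using rev_surface_dv(1) by simp
qed

lemma du_du_surface: "s \<in> S \<Longrightarrow> du S (du S (rev_surface \<beta>)) s \<theta> = rev_surface \<beta>2 s \<theta>"
  unfolding du_def[of S "du S (rev_surface \<beta>)"]
  using vector_derivative_within[OF nontrivial du_du_has_derivative] by blast

lemma dv_du_surface: "s \<in> S \<Longrightarrow> dv UNIV (du S (rev_surface \<beta>)) s \<theta> = rev_tangent \<beta>1 s \<theta>"
  unfolding dv_def by (rule vector_derivative_at[OF dv_du_has_derivative])

lemma du_dv_surface: "s \<in> S \<Longrightarrow> du S (rev_tangent \<beta>) s \<theta> = rev_tangent \<beta>1 s \<theta>"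
  unfolding du_def using vector_derivative_within[OF nontrivial surface_has_derivatives(3)] by blast

lemma continuous_on_profile: "continuous_on S \<beta>" "continuous_on S \<beta>1"
  using deriv1 deriv2 has_vector_derivative_continuous continuous_on_eq_continuous_within by blast+

lemma C2_surface: "C2_surface_on S UNIV (rev_surface \<beta>)"
proof -
  \<comment> \<open>The closed forms of the partial derivatives are known for \<open>s\<close> in
    \<open>S\<close> only, so they may be substituted only under continuity on
    \<open>S \<times> UNIV\<close>.\<close>
  have cong: "continuous_on (S \<times> UNIV) (\<lambda>(s, \<theta>). f s \<theta>) \<longleftrightarrow> continuous_on (S \<times> UNIV) (\<lambda>(s, \<theta>). g s \<theta>)"
    if "\<And>s \<theta>. s \<in> S \<Longrightarrow> f s \<theta> = g s \<theta>" for f g :: "real \<Rightarrow> real \<Rightarrow> real^3"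
    using that by (intro continuous_on_cong) auto
  note diff = surface_has_derivatives(1,3)[THEN differentiableI_vector]
    du_du_has_derivative[THEN differentiableI_vector] dv_du_has_derivative[THEN differentiableI_vector]
    rev_surface_dv[THEN differentiableI_vector]
  note cont = continuous_on_rev_surface[OF continuous_on_profile(1)]
    continuous_on_rev_surface[OF continuous_on_profile(2)] continuous_on_rev_surface[OF cont2]
  show ?thesis
    unfolding C2_surface_on_def C1_surface_on_def dv_surface
    using diff cont
    by (simp add: cong[OF du_surface] cong[OF du_du_surface]
        cong[OF dv_du_surface] cong[OF du_dv_surface])
qed

lemma C2_curve: "C2_curve_on S \<beta>"
  using C2_curve_on_I[OF nontrivial deriv1 deriv2 cont2] .

lemma rev_normal_eq:
  "s \<in> S \<Longrightarrow> rev_normal S \<beta> s \<theta> = vector [- (\<beta>1 s $ 3), - (\<beta>1 s $ 1) * sinh \<theta>, - (\<beta>1 s $ 1) * cosh \<theta>]"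
  by (simp add: rev_normal_def vector_derivative_profile Let_def)

lemma fundamental_forms:
  assumes "s \<in> S"
  shows "g11 S (rev_surface \<beta>) s \<theta> = (\<beta>1 s $ 1)\<^sup>2 - (\<beta>1 s $ 3)\<^sup>2"
    "g12 S UNIV (rev_surface \<beta>) s \<theta> = 0"
    "g22 UNIV (rev_surface \<beta>) s \<theta> = (\<beta> s $ 3)\<^sup>2"
    "h11 S (rev_surface \<beta>) (rev_normal S \<beta>) s \<theta> = \<beta>1 s $ 1 * \<beta>2 s $ 3 - \<beta>2 s $ 1 * \<beta>1 s $ 3"
    "h22 UNIV (rev_surface \<beta>) (rev_normal S \<beta>) s \<theta> = \<beta> s $ 3 * \<beta>1 s $ 1"
    "lorentz (rev_normal S \<beta> s \<theta>) (rev_normal S \<beta> s \<theta>) = (\<beta>1 s $ 3)\<^sup>2 - (\<beta>1 s $ 1)\<^sup>2"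
    "lorentz (rev_normal S \<beta> s \<theta>) (du S (rev_surface \<beta>) s \<theta>) = 0"
    "lorentz (rev_normal S \<beta> s \<theta>) (dv UNIV (rev_surface \<beta>) s \<theta>) = 0"
  using hyperbolic_pythagoras[of \<theta>]
  unfolding g11_def g12_def g22_def h11_def h22_def dv_surface
  by (simp_all add: du_surface[OF assms] du_du_surface[OF assms] rev_normal_eq[OF assms]
      lorentz_def rev_surface_def rev_tangent_def rev_radius_def power2_eq_square; algebra)+

text \<open>The coordinates are orthogonal with metric determinant
  \<open>\<eta> * z\<^sup>2\<close>, and the normal has sign \<open>- \<eta>\<close>; these two
  signs cancel.\<close>

lemma mean_curvature_eq:
  assumes "s \<in> S" "\<eta> \<in> {-1, 1}" "(\<beta>1 s $ 1)\<^sup>2 - (\<beta>1 s $ 3)\<^sup>2 = \<eta>" "\<beta> s $ 3 \<noteq> 0"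
  shows "mean_curvature S UNIV (rev_surface \<beta>) (rev_normal S \<beta>) s \<theta> =
    - (\<eta> * \<beta>1 s $ 1 / \<beta> s $ 3 + \<beta>1 s $ 1 * \<beta>2 s $ 3 - \<beta>2 s $ 1 * \<beta>1 s $ 3) / 2"
proof -
  have N: "(\<beta>1 s $ 3)\<^sup>2 - (\<beta>1 s $ 1)\<^sup>2 = - \<eta>" using assms(3) by simp
  show ?thesis
    unfolding mean_curvature_def fundamental_forms[OF assms(1)] assms(3) N
    using assms(2,4) by (auto simp: field_simps power2_eq_square)
qed

end

text \<open>This reduces the geometric condition to two scalar equations for the profile: unit
  speed, which together with \<open>z > 0\<close> makes the surface non-lightlike with unit normal,
  and the curvature equation.\<close>

lemma generates_rev_surface_iff:
  assumes "C2_profile S \<beta> \<beta>1 \<beta>2" "\<eta> \<in> {-1, 1}"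
    and "\<And>s. s \<in> S \<Longrightarrow> \<beta> s $ 2 = 0 \<and> \<beta>1 s $ 2 = 0 \<and> \<beta> s $ 3 > 0"
  shows "generates_rev_surface S \<eta> \<beta> H \<longleftrightarrow> continuous_on S H \<and>
    (\<forall>s\<in>S. (\<beta>1 s $ 1)\<^sup>2 - (\<beta>1 s $ 3)\<^sup>2 = \<eta> \<and>
      \<eta> * \<beta>1 s $ 1 / \<beta> s $ 3 + \<beta>1 s $ 1 * \<beta>2 s $ 3 - \<beta>2 s $ 1 * \<beta>1 s $ 3 = - 2 * H s)"
    (is "_ = ?R")
proof -
  interpret C2_profile S \<beta> \<beta>1 \<beta>2 by fact
  have lor: "lorentz (\<beta>1 s) (\<beta>1 s) = (\<beta>1 s $ 1)\<^sup>2 - (\<beta>1 s $ 3)\<^sup>2" if "s \<in> S" for s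
    using assms(3)[OF that] by (simp add: lorentz_def power2_eq_square)
  have N: "nonlightlike_C2_surface_on S UNIV (rev_surface \<beta>) (rev_normal S \<beta>)"
    if unit: "\<forall>s\<in>S. (\<beta>1 s $ 1)\<^sup>2 - (\<beta>1 s $ 3)\<^sup>2 = \<eta>"
  proof -
    have "(\<beta>1 s $ 3)\<^sup>2 - (\<beta>1 s $ 1)\<^sup>2 = - \<eta>" if "s \<in> S" for s using unit that by force
    then show ?thesis
      using C2_surface assms(2,3) unit
      unfolding nonlightlike_C2_surface_on_def by (fastforce simp: fundamental_forms)
  qed
  have H: "mean_curvature S UNIV (rev_surface \<beta>) (rev_normal S \<beta>) s \<theta> = H s \<longleftrightarrow>
      \<eta> * \<beta>1 s $ 1 / \<beta> s $ 3 + \<beta>1 s $ 1 * \<beta>2 s $ 3 - \<beta>2 s $ 1 * \<beta>1 s $ 3 = - 2 * H s"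
    if "s \<in> S" "(\<beta>1 s $ 1)\<^sup>2 - (\<beta>1 s $ 3)\<^sup>2 = \<eta>" for s \<theta>
  proof -
    have linear: "m = h \<longleftrightarrow> c = - 2 * h" if "m = - c / 2" for m c h :: real
      using that by auto
    have "\<beta> s $ 3 \<noteq> 0" using assms(3)[OF that(1)] by simp
    then show ?thesis
      by (intro linear mean_curvature_eq[OF that(1) assms(2) that(2)])
  qed
  show ?thesis
    unfolding generates_rev_surface_def using C2_curve N assms(3) H
    by (simp add: vector_derivative_profile lor cong: conj_cong) blast
qed

section \<open>Algebra linking the curvature equation to the linear system\<close>

text \<open>Here \<open>P\<close>, \<open>Q\<close>, \<open>w\<close> stand for values of
  \<open>p\<close>, \<open>q\<close>, \<open>z\<close>, while \<open>x2\<close> and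
  \<open>z2\<close> are the quotient-rule derivatives of \<open>x1\<close> and \<open>z1\<close>
  under the linear system. In \<open>x1 * z2 - x2 * z1\<close> the terms containing
  \<open>w' = z1\<close> cancel, and the remaining \<open>P / w\<^sup>2\<close> cancels against
  \<open>\<eta> * x1 / w\<close>.\<close>

lemma profile_curvature_identity:
  fixes P Q w k \<eta> h :: real
  assumes "w > 0" "\<eta> \<in> {-1, 1}" "P\<^sup>2 - Q\<^sup>2 = \<eta> * w\<^sup>2"
  defines "k \<equiv> 2 * \<eta> * h"
  defines "x1 \<equiv> - \<eta> * (P / w)" and "z1 \<equiv> \<eta> * (Q / w)"
  defines "x2 \<equiv> - \<eta> * ((k * Q * w - P * z1) / w\<^sup>2)"
    and "z2 \<equiv> \<eta> * (((k * P - 1) * w - Q * z1) / w\<^sup>2)"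
  shows "x1\<^sup>2 - z1\<^sup>2 = \<eta>" "\<eta> * x1 / w + x1 * z2 - x2 * z1 = - 2 * h"
proof -
  have "\<eta>\<^sup>2 = 1" using assms(2) by auto
  have "x1\<^sup>2 - z1\<^sup>2 = \<eta>\<^sup>2 * (P\<^sup>2 - Q\<^sup>2) / w\<^sup>2"
    unfolding x1_def z1_def using assms(1)
    by (simp add: field_simps power2_eq_square)
  then show "x1\<^sup>2 - z1\<^sup>2 = \<eta>" using assms(1,3) \<open>\<eta>\<^sup>2 = 1\<close> by simp
  have "\<eta> * x1 / w + x1 * z2 - x2 * z1
      = - \<eta>\<^sup>2 * (P / w\<^sup>2) - \<eta>\<^sup>2 * ((k * (P\<^sup>2 - Q\<^sup>2) - P) / w\<^sup>2)"
    unfolding x1_def z1_def x2_def z2_def using assms(1)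
    by (simp add: field_simps power2_eq_square)
  also have "\<dots> = - k * \<eta>"
    unfolding assms(3) \<open>\<eta>\<^sup>2 = 1\<close> using assms(1) by (simp add: field_simps)
  also have "\<dots> = - 2 * h" unfolding k_def using \<open>\<eta>\<^sup>2 = 1\<close> by (simp add: power2_eq_square)
  finally show "\<eta> * x1 / w + x1 * z2 - x2 * z1 = - 2 * h" .
qed

text \<open>The differentiated unit speed relation and the curvature equation are linear in
  \<open>x2\<close> and \<open>z2\<close>; solving them gives the derivatives of
  \<open>z * x1\<close> and \<open>z * z1\<close>, hence the linear system for \<open>p\<close> and
  \<open>q\<close>.\<close>

lemma profile_second_derivatives:
  fixes x1 z1 x2 z2 z h \<eta> :: real
  assumes "z > 0" "\<eta> \<in> {-1, 1}" "x1\<^sup>2 - z1\<^sup>2 = \<eta>" "x1 * x2 = z1 * z2"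
    and "\<eta> * x1 / z + x1 * z2 - x2 * z1 = - 2 * h"
  shows "z1 * x1 + z * x2 = - 2 * \<eta> * h * (z * z1)"
    "z1\<^sup>2 + z * z2 = - \<eta> - 2 * \<eta> * h * (z * x1)"
proof -
  have "\<eta>\<^sup>2 = 1" using assms(2) by auto
  have W: "z * (x1 * z2 - x2 * z1) = - 2 * h * z - \<eta> * x1"
    using assms(1,5) by (simp add: field_simps)
  \<comment> \<open>Replacing \<open>\<eta>\<close> by \<open>x1\<^sup>2 - z1\<^sup>2\<close> and
    using orthogonality exposes the common factor \<open>x1 * z2 - x2 * z1\<close>, which
    \<open>W\<close> expresses through \<open>h\<close>.\<close>
  have "\<eta> * x2 = x1 * (z1 * z2) - z1\<^sup>2 * x2"
    unfolding assms(3)[symmetric] assms(4)[symmetric]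
    by (simp add: power2_eq_square algebra_simps)
  moreover have "\<eta> * z2 = x1\<^sup>2 * z2 - z1 * (x1 * x2)"
    unfolding assms(3)[symmetric] assms(4) by (simp add: power2_eq_square algebra_simps)
  ultimately have "\<eta> * x2 = z1 * (x1 * z2 - x2 * z1)" "\<eta> * z2 = x1 * (x1 * z2 - x2 * z1)"
    by (simp_all add: power2_eq_square algebra_simps)
  then have "\<eta> * (z * x2) = z1 * (z * (x1 * z2 - x2 * z1))" "\<eta> * (z * z2) = x1 * (z * (x1 * z2 - x2 * z1))"
    by (simp_all add: mult.left_commute)
  then have "z * x2 = \<eta> * (z1 * (- 2 * h * z - \<eta> * x1))" "z * z2 = \<eta> * (x1 * (- 2 * h * z - \<eta> * x1))"
    unfolding W using assms(2) by auto
  moreover have "x1\<^sup>2 = z1\<^sup>2 + \<eta>" using assms(3) by simp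
  ultimately show "z1 * x1 + z * x2 = - 2 * \<eta> * h * (z * z1)"
    "z1\<^sup>2 + z * z2 = - \<eta> - 2 * \<eta> * h * (z * x1)"
    using assms(2) by (auto simp: power2_eq_square algebra_simps)
qed

subsection \<open>Curves with prescribed mean curvature\<close>

locale prescribed_curvature =
  fixes I :: "real set" and \<eta> :: real and H :: "real \<Rightarrow> real"
  assumes interval: "is_interval I" and zero: "0 \<in> I" and nondegenerate: "I \<noteq> {0}"
    and sign: "\<eta> \<in> {-1, 1}" and cont_H: "continuous_on I H"
begin

lemma sign_square: "\<eta> * \<eta> = 1"
  using sign by auto

definition \<phi> :: "real \<Rightarrow> real" where "\<phi> s = 2 * \<eta> * (LBINT u=0..s. H u)"

text \<open>A connected set with more than one point has no isolated points; this makes derivatives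
  within \<open>I\<close> unique.\<close>

lemma nontrivial_I: "s \<in> I \<Longrightarrow> at s within I \<noteq> bot"
  using connected_imp_perfect[of I s] interval nondegenerate zero
  by (metis is_interval_connected singletonD trivial_limit_within)

lemma integral_deriv:
  assumes "continuous_on I f" "s \<in> I"
  shows "((\<lambda>u. LBINT t=0..u. f t) has_real_derivative f s) (at s within I)"
proof (rule interval_integral_has_derivative_within[OF interval zero \<open>s \<in> I\<close>])
  show "set_integrable lborel {c..d} f" if "{c..d} \<subseteq> I" for c d
    using borel_integrable_atLeastAtMost'[OF continuous_on_subset[OF assms(1) that]] .
  show "continuous (at s within I) f"
    using assms continuous_on_eq_continuous_within by blast
qed

lemma \<phi>_deriv: "s \<in> I \<Longrightarrow> (\<phi> has_real_derivative 2 * \<eta> * H s) (at s within I)"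
  unfolding \<phi>_def[abs_def] by (rule DERIV_cmult, rule integral_deriv[OF cont_H])

lemma cont_\<phi>: "continuous_on I \<phi>"
  by (rule DERIV_continuous_on, erule \<phi>_deriv)

lemma f2_deriv: "s \<in> I \<Longrightarrow> (f2 \<eta> H has_real_derivative sinh (\<phi> s)) (at s within I)"
  unfolding f2_def[abs_def] \<phi>_def[symmetric] by (intro integral_deriv continuous_intros cont_\<phi>)

lemma g2_deriv: "s \<in> I \<Longrightarrow> (g2 \<eta> H has_real_derivative cosh (\<phi> s)) (at s within I)"
  unfolding g2_def[abs_def] \<phi>_def[symmetric] by (intro integral_deriv continuous_intros cont_\<phi>)

text \<open>\<open>deriv\<close> is two-sided, while the derivatives of \<open>f2\<close> and
  \<open>g2\<close> are known within \<open>I\<close> only; the two notions agree at interior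
  points.\<close>

lemma deriv_f2_g2:
  assumes "t \<in> interior I"
  shows "deriv (f2 \<eta> H) t = sinh (\<phi> t)" "deriv (g2 \<eta> H) t = cosh (\<phi> t)"
proof -
  have "t \<in> I" using assms interior_subset by blast
  then show "deriv (f2 \<eta> H) t = sinh (\<phi> t)" "deriv (g2 \<eta> H) t = cosh (\<phi> t)"
    using f2_deriv[of t] g2_deriv[of t] unfolding at_within_interior[OF assms]
    by (simp_all add: DERIV_imp_deriv)
qed

section \<open>The linear system and its hyperbolic rotation\<close>

definition F :: "real^3 \<Rightarrow> real \<Rightarrow> real" where "F b s = f2 \<eta> H s - \<eta> * b$1"
definition G :: "real^3 \<Rightarrow> real \<Rightarrow> real" where "G b s = g2 \<eta> H s - \<eta> * b$2"

text \<open>The substitution taking \<open>(p, q)\<close> to \<open>(F, G)\<close> is an involution,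
  so \<open>p\<close> and \<open>q\<close> come back from \<open>F\<close> and \<open>G\<close> by
  the same formulas.\<close>

definition p :: "real^3 \<Rightarrow> real \<Rightarrow> real" where
  "p b s = cosh (\<phi> s) * F b s - sinh (\<phi> s) * G b s"
definition q :: "real^3 \<Rightarrow> real \<Rightarrow> real" where
  "q b s = sinh (\<phi> s) * F b s - cosh (\<phi> s) * G b s"

lemma F_G_deriv:
  assumes "s \<in> I"
  shows "(F b has_real_derivative sinh (\<phi> s)) (at s within I)"
    "(G b has_real_derivative cosh (\<phi> s)) (at s within I)"
  unfolding F_def[abs_def] G_def[abs_def]
  using DERIV_diff[OF f2_deriv[OF assms] DERIV_const] DERIV_diff[OF g2_deriv[OF assms] DERIV_const]
  by simp_all

text \<open>Differentiating the coefficients exchanges \<open>p\<close> and \<open>q\<close> up to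
  the factor \<phi>'; differentiating \<open>F\<close> and \<open>G\<close> contributes
  \<open>0\<close> and \<open>sinh\<^sup>2 - cosh\<^sup>2 = -1\<close>.\<close>

lemma p_q_deriv:
  assumes "s \<in> I"
  shows "(p b has_real_derivative 2 * \<eta> * H s * q b s) (at s within I)"
    "(q b has_real_derivative 2 * \<eta> * H s * p b s - 1) (at s within I)"
proof -
  note [derivative_intros] = F_G_deriv[OF assms] \<phi>_deriv[OF assms]
  show "(p b has_real_derivative 2 * \<eta> * H s * q b s) (at s within I)"
    unfolding p_def[abs_def] q_def
    by (rule derivative_eq_intros refl)+ (simp add: algebra_simps)
  show "(q b has_real_derivative 2 * \<eta> * H s * p b s - 1) (at s within I)"
    unfolding q_def[abs_def] p_def
    by (rule derivative_eq_intros refl)+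
      (use hyperbolic_pythagoras[of "\<phi> s"] in \<open>simp add: algebra_simps power2_eq_square\<close>)
qed

lemma p_q_square: "(p b s)\<^sup>2 - (q b s)\<^sup>2 = \<eta> * radicand \<eta> H b s"
proof -
  have "(p b s)\<^sup>2 - (q b s)\<^sup>2 = ((cosh (\<phi> s))\<^sup>2 - (sinh (\<phi> s))\<^sup>2) * ((F b s)\<^sup>2 - (G b s)\<^sup>2)"
    unfolding p_def q_def by (simp add: power2_eq_square algebra_simps)
  then show ?thesis
    unfolding radicand_def F_def G_def hyperbolic_pythagoras
    by (simp add: sign_square flip: mult.assoc)
qed

section \<open>Integrability of the slope and the first coordinate of the curve\<close>

lemma cont_radicand: "continuous_on I (radicand \<eta> H b)"
proof -
  have "continuous_on I (F b)" "continuous_on I (G b)"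
    by (rule DERIV_continuous_on, erule F_G_deriv)+
  then show ?thesis
    unfolding radicand_def[abs_def] F_def[symmetric] G_def[symmetric] by (intro continuous_intros)
qed

text \<open>With \<open>A = G - F\<close> and \<open>B = G + F\<close> the radicand is
  \<open>- \<eta> * A * B\<close> and \<open>p = (B * A' - A * B') / 2\<close>. Both derivatives are
  positive exponentials, so each summand has only the integrable singularity treated above.\<close>

lemma set_integrable_slope:
  assumes sub: "{c..d} \<subseteq> I"
  shows "set_integrable lborel {c..d} (\<lambda>t. - \<eta> * (p b t / sqrt (radicand \<eta> H b t)))"
proof -
  define A where "A t = G b t - F b t" for t
  define B where "B t = G b t + F b t" for t
  define A' where "A' t = cosh (\<phi> t) - sinh (\<phi> t)" for t
  define B' where "B' t = cosh (\<phi> t) + sinh (\<phi> t)" for t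
  have der: "(A has_real_derivative A' t) (at t within {c..d})"
    "(B has_real_derivative B' t) (at t within {c..d})" if "t \<in> {c..d}" for t
    unfolding A_def[abs_def] B_def[abs_def] A'_def B'_def
    using DERIV_subset[OF F_G_deriv(1) sub, of t] DERIV_subset[OF F_G_deriv(2) sub, of t] that sub
    by (auto intro!: DERIV_diff DERIV_add)
  have pos: "A' t > 0" "B' t > 0" for t
    unfolding A'_def B'_def by (simp_all add: cosh_minus_sinh cosh_plus_sinh)
  have "continuous_on {c..d} \<phi>" using continuous_on_subset[OF cont_\<phi> sub] .
  then have cont: "continuous_on {c..d} A'" "continuous_on {c..d} B'"
    unfolding A'_def B'_def by (intro continuous_intros; simp)+
  have "continuous_on {c..d} A" "continuous_on {c..d} B"
    by (rule DERIV_continuous_on, erule der)+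
  then have "set_integrable lborel {c..d} (\<lambda>t. sqrt \<bar>B t\<bar> / 2 * (A' t / sqrt (A t)))"
    "set_integrable lborel {c..d} (\<lambda>t. sqrt \<bar>A t\<bar> / 2 * (B' t / sqrt (B t)))"
    by (intro set_integrable_mult_derivative_over_sqrt der pos cont continuous_intros; simp)+
  then have "set_integrable lborel {c..d}
      (\<lambda>t. sqrt \<bar>B t\<bar> / 2 * (A' t / sqrt (A t)) - sqrt \<bar>A t\<bar> / 2 * (B' t / sqrt (B t)))"
    by (rule set_integral_diff(1))
  moreover have "- \<eta> * (p b t / sqrt (radicand \<eta> H b t))
      = sqrt \<bar>B t\<bar> / 2 * (A' t / sqrt (A t)) - sqrt \<bar>A t\<bar> / 2 * (B' t / sqrt (B t))" for t
  proof -
    have p_eq: "p b t = (B t * A' t - A t * B' t) / 2"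
      unfolding p_def A_def B_def A'_def B'_def by (simp add: algebra_simps)
    have "radicand \<eta> H b t = - \<eta> * A t * B t"
      unfolding radicand_def F_def[symmetric] G_def[symmetric] A_def B_def
      by (simp add: power2_eq_square algebra_simps)
    \<comment> \<open>The odd \<open>sqrt\<close> is multiplicative on all reals and satisfies
      \<open>sqrt (- \<eta>) = - \<eta>\<close>, so no case split on the signs of \<open>A\<close>
      and \<open>B\<close> arises.\<close>
    then have "sqrt (radicand \<eta> H b t) = - \<eta> * (sqrt (A t) * sqrt (B t))"
      using sign by (auto simp: real_sqrt_mult real_sqrt_minus)
    then have "- \<eta> * (p b t / sqrt (radicand \<eta> H b t)) = p b t / (sqrt (A t) * sqrt (B t))"
      using sign by auto
    also have "\<dots> = (B t * A' t - A t * B' t) / 2 / (sqrt (A t) * sqrt (B t))"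
      unfolding p_eq ..
    also have "\<dots> = (B t / sqrt (B t)) / 2 * (A' t / sqrt (A t))
        - (A t / sqrt (A t)) / 2 * (B' t / sqrt (B t))"
      \<comment> \<open>At a zero of \<open>A\<close> or \<open>B\<close> both sides are
        \<open>0\<close>, by division by zero.\<close>
      by (cases "A t = 0"; cases "B t = 0") (auto simp: field_simps)
    finally show ?thesis unfolding divide_sqrt_self .
  qed
  ultimately show ?thesis by simp
qed

text \<open>The integral sees only the open interval between \<open>0\<close> and \<open>s\<close>.
  It lies in the interior of \<open>I\<close>, where \<open>deriv\<close> has the expected values,
  even if \<open>0\<close> or \<open>s\<close> is an end point.\<close>

lemma rev_curve_nth:
  assumes "s \<in> I"
  shows "rev_curve \<eta> H b s $ 1 = (LBINT t=0..s. - \<eta> * (p b t / sqrt (radicand \<eta> H b t))) + b$3"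
proof -
  have "t \<in> interior I" if "t \<in> einterval (min 0 (ereal s)) (max 0 (ereal s))" for t
  proof -
    have "{min 0 s<..<max 0 s} \<subseteq> I"
      using mem_is_interval_1_I[OF interval, of "min 0 s" "max 0 s"] zero assms
      by (auto simp: min_def max_def)
    moreover have "t \<in> {min 0 s<..<max 0 s}"
      using that by (auto simp: einterval_iff min_def max_def zero_ereal_def split: if_splits)
    ultimately show ?thesis using interior_maximal open_greaterThanLessThan by blast
  qed
  then show ?thesis
    unfolding rev_curve_def vector_3 p_def F_def G_def
    by (simp add: deriv_f2_g2 cong: interval_integral_cong)
qed

text \<open>A nonzero radicand at \<open>s\<close> makes the integrand continuous there; zeros
  elsewhere between \<open>0\<close> and \<open>s\<close> are harmless because the integrand stays
  integrable.\<close>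

lemma rev_curve_abscissa_deriv:
  assumes "s \<in> I" "radicand \<eta> H b s \<noteq> 0"
  shows "((\<lambda>s. rev_curve \<eta> H b s $ 1) has_real_derivative
    - \<eta> * (p b s / sqrt (radicand \<eta> H b s))) (at s within I)"
proof -
  have "continuous_on I (p b)" by (rule DERIV_continuous_on, erule p_q_deriv)
  then have "continuous (at s within I) (\<lambda>t. - \<eta> * (p b t / sqrt (radicand \<eta> H b t)))"
    using cont_radicand[of b] assms unfolding continuous_on_eq_continuous_within
    by (intro continuous_intros) auto
  then have "((\<lambda>s. (LBINT t=0..s. - \<eta> * (p b t / sqrt (radicand \<eta> H b t))) + b$3)
      has_real_derivative - \<eta> * (p b s / sqrt (radicand \<eta> H b s)) + 0) (at s within I)"
    using interval_integral_has_derivative_within[OF interval zero assms(1) set_integrable_slope]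
    by (intro DERIV_add DERIV_const) blast
  then have "((\<lambda>s. (LBINT t=0..s. - \<eta> * (p b t / sqrt (radicand \<eta> H b t))) + b$3)
      has_vector_derivative - \<eta> * (p b s / sqrt (radicand \<eta> H b s))) (at s within I)"
    by (simp add: has_real_derivative_iff_has_vector_derivative)
  then show ?thesis
    unfolding has_real_derivative_iff_has_vector_derivative
    by (intro has_vector_derivative_transform[OF assms(1) rev_curve_nth])
qed

text \<open>By continuity the positivity set is relatively open in \<open>I\<close>, so restricting
  to it leaves one-sided and two-sided limits unchanged.\<close>

lemma at_within_radicand_pos:
  assumes "s \<in> I" "radicand \<eta> H b s > 0"
  shows "at s within {s \<in> I. radicand \<eta> H b s > 0} = at s within I"
proof -
  obtain U where "open U" "{s \<in> I. radicand \<eta> H b s > 0} = I \<inter> U"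
    using continuous_openin_preimage_gen[OF cont_radicand open_greaterThan[of 0], of b]
    by (auto simp: openin_open)
  moreover have "s \<in> U" using assms calculation by auto
  ultimately show ?thesis by (intro at_within_nhd[of s U]) auto
qed

text \<open>The third coordinate is \<open>z\<close> and the first has slope
  \<open>- \<eta> * p / z\<close>. The system for \<open>p\<close> and \<open>q\<close> then yields
  both second derivatives by the quotient rule, and the equations for the profile become an
  algebraic identity.\<close>

lemma rev_curve_generates:
  "generates_rev_surface {s \<in> I. radicand \<eta> H b s > 0} \<eta> (rev_curve \<eta> H b) H"
proof -
  define S where "S = {s \<in> I. radicand \<eta> H b s > 0}"
  have S: "s \<in> I" "radicand \<eta> H b s > 0" if "s \<in> S" for s
    using that by (auto simp: S_def)
  have at: "at s within S = at s within I" if "s \<in> S" for s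
    unfolding S_def using at_within_radicand_pos S[OF that] .
  define z where "z s = sqrt (radicand \<eta> H b s)" for s
  define x1 where "x1 s = - \<eta> * (p b s / z s)" for s
  define z1 where "z1 s = \<eta> * (q b s / z s)" for s
  define k where "k s = 2 * \<eta> * H s" for s
  define x2 where "x2 s = - \<eta> * ((k s * q b s * z s - p b s * z1 s) / (z s)\<^sup>2)" for s
  define z2 where "z2 s = \<eta> * (((k s * p b s - 1) * z s - q b s * z1 s) / (z s)\<^sup>2)" for s
  have z_pos: "z s > 0" "(z s)\<^sup>2 = radicand \<eta> H b s" if "s \<in> S" for s
    using S[OF that] by (auto simp: z_def)
  have dx: "((\<lambda>s. rev_curve \<eta> H b s $ 1) has_real_derivative x1 s) (at s within S)" if "s \<in> S" for s
    using rev_curve_abscissa_deriv[of s b] S[OF that] unfolding x1_def z_def at[OF that] by simp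
  have dp: "(p b has_real_derivative k s * q b s) (at s within S)"
    "(q b has_real_derivative k s * p b s - 1) (at s within S)" if "s \<in> S" for s
    using p_q_deriv[of s b] S[OF that] unfolding at[OF that] k_def by simp_all
  have dz: "(z has_real_derivative z1 s) (at s within S)" if "s \<in> S" for s
  proof -
    note F_G_deriv[OF S(1)[OF that], of b, unfolded at[OF that, symmetric], derivative_intros]
    \<comment> \<open>The derivative of the radicand is a multiple of \<open>q\<close>, and the
      chain rule for \<open>sqrt\<close> turns it into \<open>\<eta> * q / z\<close>.\<close>
    have "((\<lambda>s. \<eta> * ((F b s)\<^sup>2 - (G b s)\<^sup>2)) has_real_derivative 2 * \<eta> * q b s) (at s within S)"
      unfolding q_def by (rule derivative_eq_intros refl)+ (simp add: algebra_simps)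
    then have "(radicand \<eta> H b has_real_derivative 2 * \<eta> * q b s) (at s within S)"
      unfolding radicand_def[abs_def] F_def G_def .
    from DERIV_chain2[OF DERIV_real_sqrt this] show ?thesis
      using S[OF that] unfolding z_def[abs_def] z1_def by (simp add: field_simps)
  qed
  have dx1: "(x1 has_real_derivative x2 s) (at s within S)" if "s \<in> S" for s
    unfolding x1_def[abs_def] x2_def power2_eq_square
    using DERIV_cmult[OF DERIV_divide[OF dp(1)[OF that] dz[OF that]], of "- \<eta>"] z_pos(1)[OF that] by simp
  have dz1: "(z1 has_real_derivative z2 s) (at s within S)" if "s \<in> S" for s
    unfolding z1_def[abs_def] z2_def power2_eq_square
    using DERIV_cmult[OF DERIV_divide[OF dp(2)[OF that] dz[OF that]], of "\<eta>"] z_pos(1)[OF that]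
    by (simp add: z1_def)
  have cont_HS: "continuous_on S H"
    using continuous_on_subset[OF cont_H] by (auto simp: S_def)
  have cont: "continuous_on S (p b)" "continuous_on S (q b)" "continuous_on S z" "continuous_on S z1"
    by (rule DERIV_continuous_on, erule dp dz dz1)+
  have cont2: "continuous_on S x2" "continuous_on S z2"
    unfolding x2_def[abs_def] z2_def[abs_def] k_def
    using z_pos(1) by (intro continuous_intros cont cont_HS; force)+
  have "C2_profile S (rev_curve \<eta> H b) (\<lambda>s. vector [x1 s, 0, z1 s]) (\<lambda>s. vector [x2 s, 0, z2 s])"
  proof
    fix s assume s: "s \<in> S"
    show "at s within S \<noteq> bot" unfolding at[OF s] by (rule nontrivial_I[OF S(1)[OF s]])
    have "rev_curve \<eta> H b = (\<lambda>s. vector [rev_curve \<eta> H b s $ 1, 0, z s])"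
      by (rule ext) (simp add: rev_curve_def z_def)
    moreover have "((\<lambda>s. vector [rev_curve \<eta> H b s $ 1, 0, z s] :: real^3)
        has_vector_derivative vector [x1 s, 0, z1 s]) (at s within S)"
      using dx[OF s] dz[OF s]
      by (intro has_vector_derivative_vector3)
        (simp_all add: has_real_derivative_iff_has_vector_derivative)
    ultimately show "(rev_curve \<eta> H b has_vector_derivative vector [x1 s, 0, z1 s]) (at s within S)"
      by simp
    show "((\<lambda>s. vector [x1 s, 0, z1 s] :: real^3) has_vector_derivative vector [x2 s, 0, z2 s])
        (at s within S)"
      using dx1[OF s] dz1[OF s]
      by (intro has_vector_derivative_vector3)
        (simp_all add: has_real_derivative_iff_has_vector_derivative)
  next
    show "continuous_on S (\<lambda>s. vector [x2 s, 0, z2 s] :: real^3)"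
      by (intro continuous_on_vector3 cont2 continuous_on_const)
  qed
  moreover have "(x1 s)\<^sup>2 - (z1 s)\<^sup>2 = \<eta> \<and>
      \<eta> * x1 s / z s + x1 s * z2 s - x2 s * z1 s = - 2 * H s" if "s \<in> S" for s
    using profile_curvature_identity(1)[OF z_pos(1)[OF that] sign, of "p b s" "q b s"]
      profile_curvature_identity(2)[OF z_pos(1)[OF that] sign, of "p b s" "q b s" "H s"]
      p_q_square[of b s] z_pos(2)[OF that]
    unfolding x1_def z1_def x2_def z2_def k_def by simp
  ultimately have "generates_rev_surface S \<eta> (rev_curve \<eta> H b) H"
    by (subst generates_rev_surface_iff[OF _ sign])
      (auto simp: cont_HS rev_curve_def z_def S)
  then show ?thesis unfolding S_def .
qed

text \<open>\<open>P\<close> and \<open>Q\<close>, read off from the given curve, solve the linear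
  system. After the rotation they have the same derivatives as \<open>F\<close> and
  \<open>G\<close>, so agreement at \<open>0\<close> gives agreement on \<open>I\<close>, without a
  uniqueness theorem for differential equations.\<close>

lemma generating_curve_eq_rev_curve:
  assumes gen: "generates_rev_surface I \<eta> \<beta> H"
  shows "\<exists>b :: real^3.
    \<beta> 0 = vector [b$3, 0, sqrt (\<eta> * ((b$1)\<^sup>2 - (b$2)\<^sup>2))] \<and>
    vector_derivative \<beta> (at 0 within I) =
      ((\<eta> * ((b$1)\<^sup>2 - (b$2)\<^sup>2)) powr (-1/2)) *\<^sub>R vector [b$1, 0, b$2] \<and>
    (\<forall>s\<in>I. \<beta> s = rev_curve \<eta> H b s)"
proof -
  define \<beta>1 where "\<beta>1 s = vector_derivative \<beta> (at s within I)" for s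
  define \<beta>2 where "\<beta>2 s = vector_derivative \<beta>1 (at s within I)" for s
  have C2: "C2_curve_on I \<beta>" and \<beta>: "\<And>s. s \<in> I \<Longrightarrow> \<beta> s $ 2 = 0 \<and> \<beta> s $ 3 > 0"
    using gen unfolding generates_rev_surface_def by blast+
  interpret C2_profile I \<beta> \<beta>1 \<beta>2
    using C2_curve_onD[OF C2] nontrivial_I
    unfolding \<beta>2_def \<beta>1_def[abs_def] by unfold_locales auto
  have unique: "a = c" if "s \<in> I" "(f has_real_derivative a) (at s within I)"
    "(g has_real_derivative c) (at s within I)" "\<And>t. t \<in> I \<Longrightarrow> f t = g t" for s a c f and g :: "real \<Rightarrow> real"
    using vector_derivative_unique_within[OF nontrivial_I[OF that(1)], of f a c] that(2,3)
      has_vector_derivative_transform[of s I f g c] that(1,4)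
    unfolding has_real_derivative_iff_has_vector_derivative by blast
  define x where "x s = \<beta> s $ 1" for s
  define z where "z s = \<beta> s $ 3" for s
  define x1 where "x1 s = \<beta>1 s $ 1" for s
  define z1 where "z1 s = \<beta>1 s $ 3" for s
  define x2 where "x2 s = \<beta>2 s $ 1" for s
  define z2 where "z2 s = \<beta>2 s $ 3" for s
  have der: "(x has_real_derivative x1 s) (at s within I)"
    "(z has_real_derivative z1 s) (at s within I)"
    "(x1 has_real_derivative x2 s) (at s within I)"
    "(z1 has_real_derivative z2 s) (at s within I)" if "s \<in> I" for s
    unfolding x_def[abs_def] z_def[abs_def] x1_def[abs_def] z1_def[abs_def] x2_def z2_def
    by (intro has_vector_derivative_vec_nth deriv1 deriv2 that)+
  have \<beta>1: "\<beta>1 s $ 2 = 0" if "s \<in> I" for s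
    using unique[OF that has_vector_derivative_vec_nth[OF deriv1[OF that], of 2] DERIV_const] \<beta> by blast
  have z_pos: "z s > 0" if "s \<in> I" for s using \<beta>[OF that] by (simp add: z_def)
  have eqs: "(x1 s)\<^sup>2 - (z1 s)\<^sup>2 = \<eta>" "\<eta> * x1 s / z s + x1 s * z2 s - x2 s * z1 s = - 2 * H s"
    if "s \<in> I" for s
    using generates_rev_surface_iff[OF C2_profile_axioms sign, of H] gen \<beta> \<beta>1 that
    unfolding x1_def z_def z1_def z2_def x2_def by blast+
  \<comment> \<open>The unit speed relation is constant on \<open>I\<close>, so its derivative
    vanishes, by uniqueness of derivatives within \<open>I\<close>.\<close>
  have ortho: "x1 s * x2 s = z1 s * z2 s" if "s \<in> I" for s
  proof -
    note der[OF that, derivative_intros]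
    have "((\<lambda>s. (x1 s)\<^sup>2 - (z1 s)\<^sup>2) has_real_derivative 2 * (x1 s * x2 s - z1 s * z2 s)) (at s within I)"
      by (rule derivative_eq_intros refl)+ (simp add: algebra_simps)
    from unique[OF that this DERIV_const] eqs(1) show ?thesis by fastforce
  qed
  define P where "P s = - \<eta> * (z s * x1 s)" for s
  define Q where "Q s = \<eta> * (z s * z1 s)" for s
  have dPQ: "(P has_real_derivative 2 * \<eta> * H s * Q s) (at s within I)"
    "(Q has_real_derivative 2 * \<eta> * H s * P s - 1) (at s within I)" if "s \<in> I" for s
  proof -
    note der[OF that, derivative_intros]
    note second = profile_second_derivatives[OF z_pos sign eqs(1) ortho eqs(2), OF that that that that]
    have "(P has_real_derivative - \<eta> * (z1 s * x1 s + z s * x2 s)) (at s within I)"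
      unfolding P_def[abs_def] by (rule derivative_eq_intros refl)+ (simp add: algebra_simps)
    then show "(P has_real_derivative 2 * \<eta> * H s * Q s) (at s within I)"
      unfolding second(1) Q_def by (simp add: mult_ac)
    have "(Q has_real_derivative \<eta> * ((z1 s)\<^sup>2 + z s * z2 s)) (at s within I)"
      unfolding Q_def[abs_def]
      by (rule derivative_eq_intros refl)+ (simp add: algebra_simps power2_eq_square)
    moreover have "\<eta> * (- \<eta> - 2 * \<eta> * H s * (z s * x1 s)) = 2 * \<eta> * H s * P s - 1"
      using sign_square unfolding P_def by algebra
    ultimately show "(Q has_real_derivative 2 * \<eta> * H s * P s - 1) (at s within I)"
      unfolding second(2) by simp
  qed
  \<comment> \<open>Since \<phi>, \<open>f2\<close> and \<open>g2\<close> vanish at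
    \<open>0\<close>, this choice gives \<open>F b 0 = P 0\<close> and \<open>G b 0 = - Q 0\<close>,
    and \<open>b$3\<close> is the initial abscissa.\<close>
  define b :: "real^3" where "b = vector [z 0 * x1 0, z 0 * z1 0, x 0]"
  have at0: "\<phi> 0 = 0" "f2 \<eta> H 0 = 0" "g2 \<eta> H 0 = 0"
    by (simp_all add: \<phi>_def f2_def g2_def zero_ereal_def[symmetric])
  have convex: "convex I" using interval is_interval_convex by blast
  have const: "f s = f 0" if "s \<in> I" "\<And>s. s \<in> I \<Longrightarrow> (f has_real_derivative 0) (at s within I)"
    for s and f :: "real \<Rightarrow> real"
    using has_field_derivative_zero_constant[OF convex that(2)] that(1) zero by metis
  have F: "F b s = cosh (\<phi> s) * P s - sinh (\<phi> s) * Q s" if "s \<in> I" for s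
  proof -
    have "((\<lambda>s. F b s - (cosh (\<phi> s) * P s - sinh (\<phi> s) * Q s)) has_real_derivative 0) (at s within I)"
      if "s \<in> I" for s
    proof -
      note F_G_deriv[OF that, derivative_intros] \<phi>_deriv[OF that, derivative_intros]
        dPQ[OF that, derivative_intros]
      show ?thesis by (rule derivative_eq_intros refl)+ (simp add: algebra_simps)
    qed
    from const[OF that this] show ?thesis
      by (simp add: F_def at0 P_def b_def)
  qed
  have G: "G b s = sinh (\<phi> s) * P s - cosh (\<phi> s) * Q s" if "s \<in> I" for s
  proof -
    have "((\<lambda>s. G b s - (sinh (\<phi> s) * P s - cosh (\<phi> s) * Q s)) has_real_derivative 0) (at s within I)"
      if "s \<in> I" for s
    proof -
      note F_G_deriv[OF that, derivative_intros] \<phi>_deriv[OF that, derivative_intros]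
        dPQ[OF that, derivative_intros]
      show ?thesis by (rule derivative_eq_intros refl)+ (simp add: algebra_simps)
    qed
    from const[OF that this] show ?thesis
      by (simp add: G_def at0 Q_def b_def)
  qed
  \<comment> \<open>Applying the involution once more recovers \<open>P\<close> and
    \<open>Q\<close>.\<close>
  have p: "p b s = P s" if "s \<in> I" for s
    unfolding p_def F[OF that] G[OF that] using hyperbolic_pythagoras[of "\<phi> s"] by algebra
  have q: "q b s = Q s" if "s \<in> I" for s
    unfolding q_def F[OF that] G[OF that] using hyperbolic_pythagoras[of "\<phi> s"] by algebra
  have rad: "radicand \<eta> H b s = (z s)\<^sup>2" if "s \<in> I" for s
    using p_q_square[of b s] eqs(1)[OF that] sign_square
    unfolding p[OF that] q[OF that] P_def Q_def by algebra
  \<comment> \<open>Both abscissas have derivative \<open>x1\<close> and start at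
    \<open>x 0\<close>; the radicand equals \<open>(z s)\<^sup>2 > 0\<close> on all of
    \<open>I\<close>, so the slope formula applies everywhere.\<close>
  have "x s = rev_curve \<eta> H b s $ 1" if "s \<in> I" for s
  proof -
    have "((\<lambda>s. x s - rev_curve \<eta> H b s $ 1) has_real_derivative 0) (at s within I)" if "s \<in> I" for s
    proof -
      have "- \<eta> * (p b s / sqrt (radicand \<eta> H b s)) = x1 s"
        using z_pos[OF that] sign unfolding rad[OF that] p[OF that] P_def by auto
      then have "((\<lambda>s. rev_curve \<eta> H b s $ 1) has_real_derivative x1 s) (at s within I)"
        using rev_curve_abscissa_deriv[OF that, of b] z_pos[OF that] rad[OF that] by simp
      from DERIV_diff[OF der(1)[OF that] this] show ?thesis by simp
    qed
    moreover have "rev_curve \<eta> H b 0 $ 1 = x 0"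
      by (simp add: rev_curve_def b_def zero_ereal_def[symmetric])
    ultimately show ?thesis using const[OF that, of "\<lambda>s. x s - rev_curve \<eta> H b s $ 1"] by simp
  qed
  then have "\<beta> s = rev_curve \<eta> H b s" if "s \<in> I" for s
    using that \<beta>[OF that] rad[OF that]
    by (simp add: vec_eq_iff forall_3 x_def) (simp add: rev_curve_def z_def)
  moreover have z0: "\<eta> * ((b$1)\<^sup>2 - (b$2)\<^sup>2) = (z 0)\<^sup>2"
    using rad[OF zero] eqs(1)[OF zero] sign_square unfolding b_def vector_3 by algebra
  moreover have "\<beta> 0 = vector [b$3, 0, sqrt ((z 0)\<^sup>2)]"
    using \<beta>[OF zero] by (simp add: vec_eq_iff forall_3 b_def x_def z_def)
  moreover have "((z 0)\<^sup>2) powr (-1/2) = inverse (z 0)"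
    using z_pos[OF zero] by (simp add: powr_minus powr_half_sqrt)
  then have "\<beta>1 0 = (((z 0)\<^sup>2) powr (-1/2)) *\<^sub>R vector [b$1, 0, b$2]"
    using \<beta>1[OF zero] z_pos[OF zero] by (simp add: vec_eq_iff forall_3 b_def x1_def z1_def)
  ultimately show ?thesis unfolding \<beta>1_def by (intro exI[of _ b]) simp
qed

end

theorem theorem2p3:
  fixes I :: "real set" and \<eta> :: real
  assumes "is_interval I" and "0 \<in> I" and "I \<noteq> {0}" and "\<eta> \<in> {-1, 1}"
  shows "(\<forall>(\<beta> :: real \<Rightarrow> real^3) H. generates_rev_surface I \<eta> \<beta> H \<longrightarrow>
            (\<exists>b :: real^3.
               \<beta> 0 = vector [b$3, 0, sqrt (\<eta> * ((b$1)\<^sup>2 - (b$2)\<^sup>2))] \<and>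
               vector_derivative \<beta> (at 0 within I) =
                 ((\<eta> * ((b$1)\<^sup>2 - (b$2)\<^sup>2)) powr (-1/2)) *\<^sub>R vector [b$1, 0, b$2] \<and>
               (\<forall>s\<in>I. \<beta> s = rev_curve \<eta> H b s)))
       \<and> (\<forall>(H :: real \<Rightarrow> real) (b :: real^3).
            continuous_on I H \<longrightarrow> (b$1, b$2) \<in> S2 I \<eta> H \<longrightarrow>
            generates_rev_surface {s \<in> I. radicand \<eta> H b s > 0} \<eta> (rev_curve \<eta> H b) H)"
proof -
  have "prescribed_curvature I \<eta> H" if "continuous_on I H" for H
    using assms that by unfold_locales auto
  moreover have "continuous_on I H" if "generates_rev_surface I \<eta> \<beta> H" for \<beta> H
    using that unfolding generates_rev_surface_def by blast
  ultimately show ?thesis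
    using prescribed_curvature.generating_curve_eq_rev_curve
      prescribed_curvature.rev_curve_generates by blast
qed

end
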